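(* Let $r\in(0,\infty]$, $\delta\in[0,1)$, let $X$ be an $(r,\delta)$-convex space, $C\subseteq X$ a convex subset, $N\in\mathbb{Z}_+$, $T_1,\ldots,T_N:C\to C$ nonexpansive mappings, $u\in C$ and $(\lambda_n)_{n\ge 1}$ a sequence in $[0,1]$. Let $M>0$ be a real number with $M\le \frac r2$, and let $\alpha,\gamma:(0,\infty)\to\mathbb{Z}_+$ and $\theta:\mathbb{Z}_+\to\mathbb{Z}_+$ be functions. Suppose that (1) $\sum_{n=1}^\infty\lambda_n=\infty$ with rate of divergence $\theta$; (2) $\sum_{n=1}^\infty|\lambda_{n+N}-\lambda_n|$ converges with Cauchy modulus $\gamma$. For $\varepsilon>0$ let $$\tilde\Phi(\varepsilon,M,\gamma,\theta,\delta)=\theta\left(\left\lceil\frac1{1-\delta}\right\rceil\left(\gamma\left(\frac{\varepsilon}{4M}\right)+\max\left\{\left\lceil\ln\left(\frac{4M}{\varepsilon}\right)\right\rceil,1\right\}\right)\right),$$ $$\Phi(\varepsilon,M,\gamma,\theta,\delta,N,\alpha)=\max\left\{\tilde\Phi\left(\frac{\varepsilon}{2},M,\gamma,\theta,\delta\right),\ \alpha\left(\frac{\varepsilon}{4MN}\right)\right\}.$$ Assume that either (i) $(x_n)_{n\ge0}$ is given by $x_0=u$, $x_{n+1}=\lambda_{n+1}u+(1-\lambda_{n+1})T_{n+1}x_n$, with $d(x_n,u)\le M$ for all $n\ge1$ and $d(u,T_iu)\le M$ for each $i=1,\ldots,N$; or (ii) $(x_n)_{n\ge0}$ is given by $x_0=u$,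 $x_{n+1}=T_{n+1}(\lambda_{n+1}u+(1-\lambda_{n+1})x_n)$, with $d(x_n,u)\le M$ for all $n\ge1$. Then $\lim_{n\to\infty}d(x_n,x_{n+N})=0$ with rate of convergence $\tilde\Phi$ (as a function of $\varepsilon$). Furthermore, if $\lim_{n\to\infty}\lambda_{n+1}=0$ with rate of convergence $\alpha$, then $\lim_{n\to\infty}d(x_n,T_{n,N}(x_n))=0$ with rate of convergence $\Phi$ (as a function of $\varepsilon$).
   Context: Geodesic bicombings. Let $(X,d)$ be a metric space. A constant speed geodesic from $x$ to $y$ is a map $\gamma:[0,1]\to X$ with $\gamma(0)=x$, $\gamma(1)=y$ and $d(\gamma(s),\gamma(t))=|s-t|d(x,y)$ for all $s,t\in[0,1]$. For $r\in(0,\infty]$, an $r$-geodesic bicombing on $X$ is a choice of a constant speed geodesic $\gamma_{x,y}$ from $x$ to $y$ for each pair $x,y\in X$ with $d(x,y)\le r$ (for $r=\infty$: for all pairs). Write $(1-t)x+ty:=\gamma_{x,y}(t)$ for $t\in[0,1]$ and $[x,y]:=\gamma_{x,y}([0,1])$. In particular $\lambda u+(1-\lambda)v=\gamma_{u,v}(1-\lambda)$. For $r\in(0,\infty]$ and $\delta\in[0,1]$, a metric space $(X,d)$ with an $r$-geodesic bicombing is $(r,\delta)$-convex if for all $x,y,z\in X$ with $d(x,y),d(x,z),d(z,y)\le r$ and all $t\in[0,1]$, $$d((1-t)x+ty,(1-t)x+tz)\le(t+\delta(1-t))\,d(y,z).$$ A subset $C\subseteq X$ is convex if $[x,y]\subseteq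 C$ for all $x,y\in C$ with $d(x,y)\le r$. A map $T:C\to C$ is nonexpansive if $d(Tx,Ty)\le d(x,y)$ for all $x,y\in C$. Indices of the mappings are cyclic: $T_n:=T_{n\bmod N}$ for $n\ge1$, where the mod $N$ function takes values in $\{1,\ldots,N\}$. Put $T_{n,N}:=T_{n+N}\cdots T_{n+1}$ (composition). Convex combinations in the iterations are formed between points at distance at most $r$ (which is guaranteed by the stated bounds since $2M\le r$). Quantitative notions. $\lim_{n\to\infty} a_n=0$ (with $a_n\ge0$) with rate of convergence $\varphi:(0,\infty)\to\mathbb{Z}_+$ means: for all $\varepsilon>0$ and all $n\ge\varphi(\varepsilon)$, $a_n\le\varepsilon$. A series $\sum_{n\ge1}b_n$ with $b_n\ge0$ converges with Cauchy modulus $\gamma:(0,\infty)\to\mathbb{Z}_+$ if for all $\varepsilon>0$ and all $m\in\mathbb{Z}_+$, $\sum_{k=\gamma(\varepsilon)+1}^{\gamma(\varepsilon)+m}b_k\le\varepsilon$. A series $\sum_{n\ge1}c_n$ with $c_n\ge0$ diverges with rate of divergence $\theta:\mathbb{Z}_+\to\mathbb{Z}_+$ if $\sum_{k=1}^{\theta(n)}c_k\ge n$ for all $n\in\mathbb{Z}_+$. $\mathbb{Z}_+$ denotes the positive integers. *)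

theory Defs
  imports Complex_Main "HOL-Library.Extended_Real"
begin

definition constant_speed_geodesic :: "'a::metric_space \<Rightarrow> 'a \<Rightarrow> (real \<Rightarrow> 'a) \<Rightarrow> bool" where
  "constant_speed_geodesic x y g \<longleftrightarrow>
     g 0 = x \<and> g 1 = y \<and>
     (\<forall>s\<in>{0..1}. \<forall>t\<in>{0..1}. dist (g s) (g t) = \<bar>s - t\<bar> * dist x y)"

text \<open>
  A bicombing is a total function \<open>\<sigma>\<close>, but \<open>\<sigma> x y t\<close> is only constrained (and only
  meaningful) for \<open>dist x y \<le> r\<close> and \<open>t \<in> {0..1}\<close>; there it is the point \<open>(1 - t) x + t y\<close>.
\<close>

definition geodesic_bicombing ::
  "ereal \<Rightarrow> ('a::metric_space \<Rightarrow> 'a \<Rightarrow> real \<Rightarrow> 'a) \<Rightarrow> bool" where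
  "geodesic_bicombing r \<sigma> \<longleftrightarrow>
     (\<forall>x y. ereal (dist x y) \<le> r \<longrightarrow> constant_speed_geodesic x y (\<sigma> x y))"

definition convex_space ::
  "ereal \<Rightarrow> real \<Rightarrow> ('a::metric_space \<Rightarrow> 'a \<Rightarrow> real \<Rightarrow> 'a) \<Rightarrow> bool" where
  "convex_space r \<delta> \<sigma> \<longleftrightarrow>
     geodesic_bicombing r \<sigma> \<and>
     (\<forall>x y z. \<forall>t\<in>{0..1}.
        ereal (dist x y) \<le> r \<and> ereal (dist x z) \<le> r \<and> ereal (dist z y) \<le> r \<longrightarrow>
        dist (\<sigma> x y t) (\<sigma> x z t) \<le> (t + \<delta> * (1 - t)) * dist y z)"

definition convex_subset ::
  "ereal \<Rightarrow> ('a::metric_space \<Rightarrow> 'a \<Rightarrow> real \<Rightarrow> 'a) \<Rightarrow> 'a set \<Rightarrow> bool" where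
  "convex_subset r \<sigma> C \<longleftrightarrow>
     (\<forall>x\<in>C. \<forall>y\<in>C. ereal (dist x y) \<le> r \<longrightarrow> \<sigma> x y ` {0..1} \<subseteq> C)"

definition nonexpansive_self_map :: "'a::metric_space set \<Rightarrow> ('a \<Rightarrow> 'a) \<Rightarrow> bool" where
  "nonexpansive_self_map C f \<longleftrightarrow>
     f ` C \<subseteq> C \<and> (\<forall>x\<in>C. \<forall>y\<in>C. dist (f x) (f y) \<le> dist x y)"

text \<open>The remainder mod \<open>N\<close> with values in \<open>{1..N}\<close>, and the family indexed cyclically by it.\<close>

definition cyc_index :: "nat \<Rightarrow> nat \<Rightarrow> nat" where
  "cyc_index N n = (if n mod N = 0 then N else n mod N)"

definition cyc :: "nat \<Rightarrow> (nat \<Rightarrow> 'a \<Rightarrow> 'a) \<Rightarrow> nat \<Rightarrow> 'a \<Rightarrow> 'a" where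
  "cyc N T n = T (cyc_index N n)"

text \<open>\<open>comp_block S n k\<close> is the composition \<open>S (n + k) \<circ> \<dots> \<circ> S (n + 1)\<close>.\<close>

primrec comp_block :: "(nat \<Rightarrow> 'a \<Rightarrow> 'a) \<Rightarrow> nat \<Rightarrow> nat \<Rightarrow> 'a \<Rightarrow> 'a" where
  "comp_block S n 0 = id"
| "comp_block S n (Suc k) = S (n + Suc k) \<circ> comp_block S n k"

text \<open>
  The three quantitative notions are meant for nonnegative sequences. Series are indexed from 1.
  Functions on the positive reals or positive integers with positive integer values are
  represented as functions of type \<open>real \<Rightarrow> nat\<close> and \<open>nat \<Rightarrow> nat\<close>; positivity of their
  values is part of the definitions.
\<close>

definition rate_of_convergence :: "(nat \<Rightarrow> real) \<Rightarrow> (real \<Rightarrow> nat) \<Rightarrow> bool" where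
  "rate_of_convergence a \<phi> \<longleftrightarrow>
     (\<forall>\<epsilon>>0. \<phi> \<epsilon> \<ge> 1 \<and> (\<forall>n\<ge>\<phi> \<epsilon>. a n \<le> \<epsilon>))"

definition cauchy_modulus :: "(nat \<Rightarrow> real) \<Rightarrow> (real \<Rightarrow> nat) \<Rightarrow> bool" where
  "cauchy_modulus b \<gamma> \<longleftrightarrow>
     (\<forall>\<epsilon>>0. \<gamma> \<epsilon> \<ge> 1 \<and> (\<forall>m\<ge>1. (\<Sum>k = \<gamma> \<epsilon> + 1..\<gamma> \<epsilon> + m. b k) \<le> \<epsilon>))"

definition rate_of_divergence :: "(nat \<Rightarrow> real) \<Rightarrow> (nat \<Rightarrow> nat) \<Rightarrow> bool" where
  "rate_of_divergence c \<theta> \<longleftrightarrow>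
     (\<forall>n\<ge>1. \<theta> n \<ge> 1 \<and> (\<Sum>k = 1..\<theta> n. c k) \<ge> real n)"

definition Phi_tilde ::
  "real \<Rightarrow> real \<Rightarrow> (real \<Rightarrow> nat) \<Rightarrow> (nat \<Rightarrow> nat) \<Rightarrow> real \<Rightarrow> nat" where
  "Phi_tilde \<epsilon> M \<gamma> \<theta> \<delta> =
     \<theta> (nat \<lceil>1 / (1 - \<delta>)\<rceil> * (\<gamma> (\<epsilon> / (4 * M)) + nat (max \<lceil>ln (4 * M / \<epsilon>)\<rceil> 1)))"

definition Phi ::
  "real \<Rightarrow> real \<Rightarrow> (real \<Rightarrow> nat) \<Rightarrow> (nat \<Rightarrow> nat) \<Rightarrow> real \<Rightarrow> nat \<Rightarrow> (real \<Rightarrow> nat) \<Rightarrow> nat" where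
  "Phi \<epsilon> M \<gamma> \<theta> \<delta> N \<alpha> =
     max (Phi_tilde (\<epsilon> / 2) M \<gamma> \<theta> \<delta>) (\<alpha> (\<epsilon> / (4 * M * real N)))"

text \<open>
  In both iterations \<open>\<lambda> u + (1 - \<lambda>) v\<close> is \<open>\<sigma> u v (1 - \<lambda>)\<close>. The sequence \<open>S\<close> of
  mappings and the sequence \<open>l\<close> of weights are only used at indices \<open>n \<ge> 1\<close>.
\<close>

definition iteration_i ::
  "('a::metric_space \<Rightarrow> 'a \<Rightarrow> real \<Rightarrow> 'a) \<Rightarrow> (nat \<Rightarrow> 'a \<Rightarrow> 'a) \<Rightarrow> 'a \<Rightarrow> (nat \<Rightarrow> real) \<Rightarrow> (nat \<Rightarrow> 'a) \<Rightarrow> bool" where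
  "iteration_i \<sigma> S u l x \<longleftrightarrow>
     x 0 = u \<and> (\<forall>n. x (n + 1) = \<sigma> u (S (n + 1) (x n)) (1 - l (n + 1)))"

definition iteration_ii ::
  "('a::metric_space \<Rightarrow> 'a \<Rightarrow> real \<Rightarrow> 'a) \<Rightarrow> (nat \<Rightarrow> 'a \<Rightarrow> 'a) \<Rightarrow> 'a \<Rightarrow> (nat \<Rightarrow> real) \<Rightarrow> (nat \<Rightarrow> 'a) \<Rightarrow> bool" where
  "iteration_ii \<sigma> S u l x \<longleftrightarrow>
     x 0 = u \<and> (\<forall>n. x (n + 1) = S (n + 1) (\<sigma> u (x n) (1 - l (n + 1))))"

end

theory Submission
  imports Defs
begin

text \<open>
  Both iterations make the displacement \<open>a n = dist (x n) (x (n + N))\<close> satisfy one and the same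
  inequality,
  \<open>a (n + 1) \<le> (1 - (1 - \<delta>) * l (n + 1)) * a n + 2 * M * \<bar>l (n + 1 + N) - l (n + 1)\<bar>\<close>.
  The points \<open>x (n + 1)\<close> and \<open>x (n + 1 + N)\<close> are formed with the same map, since the indices
  of the maps are cyclic, and with the same anchor \<open>u\<close>. Only the weights and the second end points
  differ. Changing the weight moves a point along one geodesic of length at most \<open>2 * M\<close>, which
  gives the second summand; changing the end point with the weight fixed is governed by
  \<open>(r,\<delta>)\<close>-convexity, which gives the contraction factor. This is
  \<open>iteration_i_estimates\<close> and \<open>iteration_ii_estimates\<close>.

  Unrolling the inequality from the index \<open>g = \<gamma> (\<epsilon> / (4 * M))\<close> onwards leaves the product of the
  factors times \<open>2 * M\<close> plus a tail of the series of errors. The choice of \<open>g\<close> makes the tail at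
  most \<open>\<epsilon> / 2\<close>. The product is at most \<open>exp (- (1 - \<delta>) * s)\<close> where \<open>s\<close> is the sum of the weights
  after \<open>g\<close>; as the weights are at most 1, the first \<open>g\<close> of them cost at most \<open>g\<close> of the divergent
  sum, which is why \<open>g\<close> is added to the logarithm inside the argument of \<open>\<theta>\<close>. This is
  \<open>contractive_recursion_rate\<close>.

  For the second claim, one step of either iteration differs from applying the map alone by at most
  \<open>2 * M\<close> times the current weight, and nonexpansive maps do not amplify such errors. Hence \<open>N\<close>
  successive steps differ from the composed maps by at most the sum of \<open>N\<close> of these
  (\<open>perturbed_orbit_comp_block\<close>), and the triangle inequality through \<open>x (n + N)\<close> finishes.
\<close>

section \<open>Quantitative convergence of contractive recursions\<close>

text \<open>
  Each factor \<open>1 - p n\<close> is at most \<open>exp (- p n)\<close>, and it is also at most 1, so that errors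
  accumulated earlier are carried along without growth.
\<close>

lemma contractive_recursion_bound:
  fixes a b p :: "nat \<Rightarrow> real"
  assumes p: "\<And>n. n \<ge> 1 \<Longrightarrow> p n \<in> {0..1}"
    and b: "\<And>n. n \<ge> 1 \<Longrightarrow> 0 \<le> b n"
    and step: "\<And>n. a (n + 1) \<le> (1 - p (n + 1)) * a n + b (n + 1)"
    and start: "a m \<le> A" and "0 \<le> A"
  shows "a (m + k) \<le> A * exp (- (\<Sum>j = m + 1..m + k. p j)) + (\<Sum>j = m + 1..m + k. b j)"
proof (induction k)
  case 0
  then show ?case using start by simp
next
  case (Suc k)
  let ?P = "\<Sum>j = m + 1..m + k. p j" and ?B = "\<Sum>j = m + 1..m + k. b j"
  let ?q = "p (m + k + 1)"
  have q: "0 \<le> ?q" "?q \<le> 1" using p[of "m + k + 1"] by auto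
  have B: "0 \<le> ?B" by (intro sum_nonneg b) auto
  have "a (m + Suc k) \<le> (1 - ?q) * a (m + k) + b (m + k + 1)"
    using step[of "m + k"] by simp
  also have "\<dots> \<le> (1 - ?q) * (A * exp (- ?P) + ?B) + b (m + k + 1)"
    using Suc.IH q by (intro add_right_mono mult_left_mono) auto
  also have "\<dots> \<le> exp (- ?q) * (A * exp (- ?P)) + ?B + b (m + k + 1)"
  proof -
    have "(1 - ?q) * (A * exp (- ?P)) \<le> exp (- ?q) * (A * exp (- ?P))"
      using exp_ge_add_one_self[of "- ?q"] \<open>0 \<le> A\<close> by (intro mult_right_mono) auto
    moreover have "(1 - ?q) * ?B \<le> 1 * ?B"
      using q B by (intro mult_right_mono) auto
    ultimately show ?thesis by (simp add: distrib_left)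
  qed
  also have "exp (- ?q) * (A * exp (- ?P)) = A * exp (- (?P + ?q))"
    by (simp add: exp_add[symmetric] mult.left_commute)
  finally show ?case by simp
qed

text \<open>
  The argument of \<open>\<theta>\<close> is chosen so that, once its value has been reached, the weights with index
  beyond \<open>g = \<gamma> (\<epsilon> / (4 * M))\<close> sum to at least \<open>ln (4 * M / \<epsilon>) / (1 - \<delta>)\<close>. That the value exceeds
  \<open>g\<close> itself is forced by the weights being at most 1: reaching the sum \<open>K\<close> takes at least \<open>K\<close> terms.
\<close>

lemma contractive_recursion_rate:
  fixes a l b :: "nat \<Rightarrow> real" and \<delta> M :: real
  assumes \<delta>: "0 \<le> \<delta>" "\<delta> < 1" and M: "0 < M"
    and l: "\<And>n. n \<ge> 1 \<Longrightarrow> l n \<in> {0..1}"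
    and b: "\<And>n. n \<ge> 1 \<Longrightarrow> 0 \<le> b n"
    and step: "\<And>n. a (n + 1) \<le> (1 - (1 - \<delta>) * l (n + 1)) * a n + 2 * M * b (n + 1)"
    and bound: "\<And>n. a n \<le> 2 * M"
    and div: "rate_of_divergence l \<theta>"
    and cau: "cauchy_modulus b \<gamma>"
  shows "rate_of_convergence a (\<lambda>\<epsilon>. Phi_tilde \<epsilon> M \<gamma> \<theta> \<delta>)"
  unfolding rate_of_convergence_def
proof (intro allI impI conjI)
  fix \<epsilon> :: real assume \<epsilon>: "0 < \<epsilon>"
  define c where "c = 1 - \<delta>"
  define D where "D = nat \<lceil>1 / (1 - \<delta>)\<rceil>"
  define g where "g = \<gamma> (\<epsilon> / (4 * M))"
  define L where "L = nat (max \<lceil>ln (4 * M / \<epsilon>)\<rceil> 1)"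
  define K where "K = D * (g + L)"
  have Phi: "Phi_tilde \<epsilon> M \<gamma> \<theta> \<delta> = \<theta> K"
    by (simp add: Phi_tilde_def K_def D_def g_def L_def)
  have c: "0 < c" "c \<le> 1" using \<delta> by (auto simp: c_def)
  have cD: "1 \<le> c * real D"
  proof -
    have "1 / c \<le> real D" unfolding D_def c_def by linarith
    then show ?thesis using c by (simp add: field_simps)
  qed
  have D: "1 \<le> D" using cD by (cases D) auto
  have g: "1 \<le> g" and tail: "\<And>m. 1 \<le> m \<Longrightarrow> (\<Sum>k = g + 1..g + m. b k) \<le> \<epsilon> / (4 * M)"
    using cau \<epsilon> M unfolding cauchy_modulus_def g_def by auto
  have L: "1 \<le> L" "ln (4 * M / \<epsilon>) \<le> real L" unfolding L_def by linarith+
  have K: "g \<le> K" "1 \<le> K"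
    using D g unfolding K_def by (auto intro: order_trans[of _ "g + L"])
  show "1 \<le> Phi_tilde \<epsilon> M \<gamma> \<theta> \<delta>"
    using div K unfolding Phi rate_of_divergence_def by auto
  fix n assume "Phi_tilde \<epsilon> M \<gamma> \<theta> \<delta> \<le> n"
  then have n: "\<theta> K \<le> n" by (simp add: Phi)
  have "real K \<le> (\<Sum>k = 1..\<theta> K. l k)"
    using div K unfolding rate_of_divergence_def by auto
  also have "\<dots> \<le> (\<Sum>k = 1..n. l k)"
    using n l by (intro sum_mono2) auto
  finally have sumK: "real K \<le> (\<Sum>k = 1..n. l k)" .
  have "(\<Sum>k = 1..n. l k) \<le> (\<Sum>k = 1..n. 1)"
    using l by (intro sum_mono) auto
  with sumK have "K \<le> n" by simp
  with K obtain k where k: "n = g + k" using le_Suc_ex order_trans by metis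
  have split: "(\<Sum>j = 1..n. l j) = (\<Sum>j = 1..g. l j) + (\<Sum>j = g + 1..n. l j)"
    using sum.ub_add_nat[of 1 g l k] k by simp
  have "(\<Sum>j = 1..g. l j) \<le> (\<Sum>j = 1..g. 1)"
    using l by (intro sum_mono) auto
  then have "real K \<le> real g + (\<Sum>j = g + 1..n. l j)"
    using sumK split by simp
  moreover have "real g + real D * real L \<le> real K"
  proof -
    have "g + D * L \<le> K" using D unfolding K_def by (simp add: distrib_left)
    then show ?thesis by (metis of_nat_add of_nat_le_iff of_nat_mult)
  qed
  ultimately have "real D * real L \<le> (\<Sum>j = g + 1..n. l j)" by linarith
  then have "c * (real D * real L) \<le> c * (\<Sum>j = g + 1..n. l j)"
    using c by (intro mult_left_mono) auto
  moreover have "1 * real L \<le> c * real D * real L"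
    using cD by (intro mult_right_mono) auto
  ultimately have expo: "ln (4 * M / \<epsilon>) \<le> (\<Sum>j = g + 1..n. c * l j)"
    using L by (simp only: sum_distrib_left mult.assoc mult_1)
  have "a n \<le> 2 * M * exp (- (\<Sum>j = g + 1..n. c * l j)) + (\<Sum>j = g + 1..n. 2 * M * b j)"
    unfolding k
  proof (rule contractive_recursion_bound)
    show "c * l i \<in> {0..1}" if "1 \<le> i" for i
      using l[OF that] c mult_mono[of c 1 "l i" 1] by auto
    show "a (i + 1) \<le> (1 - c * l (i + 1)) * a i + 2 * M * b (i + 1)" for i
      using step[of i] unfolding c_def .
  qed (use M b bound in auto)
  moreover have "2 * M * exp (- (\<Sum>j = g + 1..n. c * l j)) \<le> \<epsilon> / 2"
  proof -
    have "exp (- (\<Sum>j = g + 1..n. c * l j)) \<le> exp (- ln (4 * M / \<epsilon>))"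
      using expo by simp
    also have "\<dots> = \<epsilon> / (4 * M)"
      using M \<epsilon> by (simp add: exp_minus)
    finally show ?thesis using M by (simp add: field_simps)
  qed
  moreover have "(\<Sum>j = g + 1..n. 2 * M * b j) \<le> \<epsilon> / 2"
  proof -
    have "(\<Sum>j = g + 1..n. b j) \<le> \<epsilon> / (4 * M)"
      using tail[of k] k M \<epsilon> by (cases "k = 0") auto
    then have "2 * M * (\<Sum>j = g + 1..n. b j) \<le> \<epsilon> / 2" using M by (simp add: field_simps)
    then show ?thesis by (simp only: sum_distrib_left)
  qed
  ultimately show "a n \<le> \<epsilon>" by linarith
qed

section \<open>Convex combinations with a common anchor\<close>

lemma geodesic_bicombing_dist:
  assumes "geodesic_bicombing r \<sigma>" and "ereal (dist u y) \<le> r"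
    and "s \<in> {0..1}" and "t \<in> {0..1}"
  shows "dist (\<sigma> u y (1 - s)) (\<sigma> u y (1 - t)) = \<bar>s - t\<bar> * dist u y"
proof -
  have "dist (\<sigma> u y (1 - s)) (\<sigma> u y (1 - t)) = \<bar>(1 - s) - (1 - t)\<bar> * dist u y"
    using assms unfolding geodesic_bicombing_def constant_speed_geodesic_def by auto
  then show ?thesis by (simp add: abs_minus_commute)
qed

lemma geodesic_bicombing_dist_endpoint:
  assumes "geodesic_bicombing r \<sigma>" and "ereal (dist u y) \<le> r" and "s \<in> {0..1}"
  shows "dist (\<sigma> u y (1 - s)) y = s * dist u y"
proof -
  have "\<sigma> u y 1 = y"
    using assms unfolding geodesic_bicombing_def constant_speed_geodesic_def by auto
  then show ?thesis
    using geodesic_bicombing_dist[OF assms, of 0] assms(3) by simp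
qed

text \<open>
  The comparison passes through the point of the geodesic to \<open>y\<close> with the weight \<open>t\<close>: from there to
  \<open>\<sigma> u y (1 - s)\<close> only the weight changes, to \<open>\<sigma> u z (1 - t)\<close> only the end point. At parameter
  \<open>1 - t\<close> the factor in \<open>(r,\<delta>)\<close>-convexity is \<open>(1 - t) + \<delta> * t = 1 - (1 - \<delta>) * t\<close>.
\<close>

lemma convex_combination_dist:
  assumes conv: "convex_space r \<delta> \<sigma>"
    and r: "ereal (dist u y) \<le> r" "ereal (dist u z) \<le> r" "ereal (dist y z) \<le> r"
    and w: "s \<in> {0..1}" "t \<in> {0..1}"
  shows "dist (\<sigma> u y (1 - s)) (\<sigma> u z (1 - t))
      \<le> \<bar>s - t\<bar> * dist u y + (1 - (1 - \<delta>) * t) * dist y z"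
proof -
  have "dist (\<sigma> u y (1 - s)) (\<sigma> u y (1 - t)) = \<bar>s - t\<bar> * dist u y"
    using conv r w by (intro geodesic_bicombing_dist) (auto simp: convex_space_def)
  moreover have "dist (\<sigma> u y (1 - t)) (\<sigma> u z (1 - t)) \<le> (1 - (1 - \<delta>) * t) * dist y z"
  proof -
    have "1 - t \<in> {0..1}" using w by simp
    then have "dist (\<sigma> u y (1 - t)) (\<sigma> u z (1 - t)) \<le> ((1 - t) + \<delta> * (1 - (1 - t))) * dist y z"
      using conv r dist_commute[of y z] unfolding convex_space_def by metis
    also have "(1 - t) + \<delta> * (1 - (1 - t)) = 1 - (1 - \<delta>) * t"
      by (simp add: algebra_simps)
    finally show ?thesis .
  qed
  ultimately show ?thesis
    using dist_triangle[of "\<sigma> u y (1 - s)" "\<sigma> u z (1 - t)" "\<sigma> u y (1 - t)"] by linarith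
qed

lemma convex_subset_combination:
  assumes "convex_subset r \<sigma> C" and "u \<in> C" and "y \<in> C"
    and "ereal (dist u y) \<le> r" and "s \<in> {0..1}"
  shows "\<sigma> u y (1 - s) \<in> C"
  using assms unfolding convex_subset_def by (auto simp: image_subset_iff)

section \<open>The two iterations\<close>

lemma nonexpansive_self_mapD:
  assumes "nonexpansive_self_map C f"
  shows "y \<in> C \<Longrightarrow> f y \<in> C"
    and "y \<in> C \<Longrightarrow> z \<in> C \<Longrightarrow> dist (f y) (f z) \<le> dist y z"
  using assms unfolding nonexpansive_self_map_def by auto

text \<open>
  Here the end points of the geodesics are \<open>S (n + 1) (x n)\<close>, whose distance to \<open>u\<close> is controlled
  by going through \<open>S (n + 1) u\<close>. This is what the bound on \<open>dist u (S n u)\<close> is for, and it is the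
  source of the constant \<open>2 * M\<close>.
\<close>

lemma iteration_i_estimates:
  assumes it: "iteration_i \<sigma> S u l x"
    and conv: "convex_space r \<delta> \<sigma>" and C: "convex_subset r \<sigma> C" "u \<in> C"
    and S: "\<And>n. n \<ge> 1 \<Longrightarrow> nonexpansive_self_map C (S n)"
    and per: "\<And>n. S (n + N) = S n"
    and l: "\<And>n. n \<ge> 1 \<Longrightarrow> l n \<in> {0..1}"
    and \<delta>: "0 \<le> \<delta>"
    and r: "ereal (2 * M) \<le> r"
    and xM: "\<And>n. dist (x n) u \<le> M"
    and uM: "\<And>n. n \<ge> 1 \<Longrightarrow> dist u (S n u) \<le> M"
  shows "x n \<in> C"
    and "dist (x (n + 1)) (x (n + 1 + N))
      \<le> (1 - (1 - \<delta>) * l (n + 1)) * dist (x n) (x (n + N)) + 2 * M * \<bar>l (n + 1 + N) - l (n + 1)\<bar>"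
    and "dist (x (n + 1)) (S (n + 1) (x n)) \<le> 2 * M * l (n + 1)"
proof -
  have bic: "geodesic_bicombing r \<sigma>" using conv by (simp add: convex_space_def)
  have x: "x (n + 1) = \<sigma> u (S (n + 1) (x n)) (1 - l (n + 1))" for n
    using it by (simp add: iteration_i_def)
  have in_r: "ereal d \<le> r" if "d \<le> 2 * M" for d
    using that r by (meson ereal_less_eq(3) order_trans)
  have near: "dist u (S (n + 1) (x n)) \<le> 2 * M" if "x n \<in> C" for n
  proof -
    have "dist (S (n + 1) u) (S (n + 1) (x n)) \<le> dist u (x n)"
      using nonexpansive_self_mapD(2)[OF S] that C by simp
    then show ?thesis
      using dist_triangle[of u "S (n + 1) (x n)" "S (n + 1) u"] uM[of "n + 1"] xM[of n]
      by (simp add: dist_commute)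
  qed
  show xC: "x n \<in> C" for n
  proof (induction n)
    case 0
    then show ?case using it C by (simp add: iteration_i_def)
  next
    case (Suc n)
    have "\<sigma> u (S (n + 1) (x n)) (1 - l (n + 1)) \<in> C"
      using Suc nonexpansive_self_mapD(1)[OF S] near l
      by (intro convex_subset_combination[OF C, where y = "S (n + 1) (x n)"] in_r) auto
    then show ?case using x[of n] by simp
  qed
  let ?y = "S (n + 1) (x (n + N))" and ?z = "S (n + 1) (x n)"
  \<comment> \<open>The next step and the step \<open>N\<close> later use the same map.\<close>
  have xN: "x (n + 1 + N) = \<sigma> u ?y (1 - l (n + 1 + N))"
    using x[of "n + N"] per[of "n + 1"] by (simp add: add_ac)
  have uy: "dist u ?y \<le> 2 * M" and uz: "dist u ?z \<le> 2 * M"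
    using near[of "n + N"] near[of n] xC per[of "n + 1"] by (simp_all add: add_ac)
  have yz: "dist ?y ?z \<le> dist (x n) (x (n + N))"
    using nonexpansive_self_mapD(2)[OF S] xC by (simp add: dist_commute)
  have "dist (x n) (x (n + N)) \<le> 2 * M"
    using dist_triangle2[of "x n" "x (n + N)" u] xM[of n] xM[of "n + N"] by simp
  then have yz2: "dist ?y ?z \<le> 2 * M" using yz by linarith
  have nonneg: "0 \<le> 1 - (1 - \<delta>) * l (n + 1)"
    using l[of "n + 1"] \<delta> mult_mono[of "1 - \<delta>" 1 "l (n + 1)" 1] by simp
  have "dist (x (n + 1 + N)) (x (n + 1))
      \<le> \<bar>l (n + 1 + N) - l (n + 1)\<bar> * dist u ?y + (1 - (1 - \<delta>) * l (n + 1)) * dist ?y ?z"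
    unfolding xN x[of n] using uy uz yz2 l
    by (intro convex_combination_dist[OF conv] in_r) auto
  also have "\<dots> \<le> \<bar>l (n + 1 + N) - l (n + 1)\<bar> * (2 * M)
      + (1 - (1 - \<delta>) * l (n + 1)) * dist (x n) (x (n + N))"
    using uy yz nonneg by (intro add_mono mult_left_mono) auto
  finally show "dist (x (n + 1)) (x (n + 1 + N))
      \<le> (1 - (1 - \<delta>) * l (n + 1)) * dist (x n) (x (n + N)) + 2 * M * \<bar>l (n + 1 + N) - l (n + 1)\<bar>"
    by (simp add: dist_commute mult.commute add.commute)
  have "dist (x (n + 1)) ?z = l (n + 1) * dist u ?z"
    unfolding x[of n] using uz l by (intro geodesic_bicombing_dist_endpoint[OF bic] in_r) auto
  also have "\<dots> \<le> l (n + 1) * (2 * M)"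
    using uz l[of "n + 1"] by (intro mult_left_mono) auto
  finally show "dist (x (n + 1)) ?z \<le> 2 * M * l (n + 1)" by (simp add: mult.commute)
qed

text \<open>
  Since \<open>S (n + 1)\<close> is applied last and is nonexpansive, it drops out of every estimate. What
  remains are geodesics from \<open>u\<close> to the points \<open>x n\<close> themselves, of length at most \<open>M\<close>; the
  estimates are stated with \<open>2 * M\<close> so that both iterations obey the same recursion.
\<close>

lemma iteration_ii_estimates:
  assumes it: "iteration_ii \<sigma> S u l x"
    and conv: "convex_space r \<delta> \<sigma>" and C: "convex_subset r \<sigma> C" "u \<in> C"
    and S: "\<And>n. n \<ge> 1 \<Longrightarrow> nonexpansive_self_map C (S n)"
    and per: "\<And>n. S (n + N) = S n"
    and l: "\<And>n. n \<ge> 1 \<Longrightarrow> l n \<in> {0..1}"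
    and \<delta>: "0 \<le> \<delta>"
    and r: "ereal (2 * M) \<le> r"
    and xM: "\<And>n. dist (x n) u \<le> M"
  shows "x n \<in> C"
    and "dist (x (n + 1)) (x (n + 1 + N))
      \<le> (1 - (1 - \<delta>) * l (n + 1)) * dist (x n) (x (n + N)) + 2 * M * \<bar>l (n + 1 + N) - l (n + 1)\<bar>"
    and "dist (x (n + 1)) (S (n + 1) (x n)) \<le> 2 * M * l (n + 1)"
proof -
  have bic: "geodesic_bicombing r \<sigma>" using conv by (simp add: convex_space_def)
  define v where "v n m = \<sigma> u (x n) (1 - l m)" for n m
  have x: "x (n + 1) = S (n + 1) (v n (n + 1))" for n
    using it by (simp add: iteration_ii_def v_def)
  have M: "0 \<le> M" using xM[of 0] zero_le_dist order_trans by blast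
  have near: "dist u (x n) \<le> 2 * M" for n
    using xM[of n] M by (simp add: dist_commute)
  have in_r: "ereal d \<le> r" if "d \<le> 2 * M" for d
    using that r by (meson ereal_less_eq(3) order_trans)
  have vC: "v n m \<in> C" if "x n \<in> C" "m \<ge> 1" for n m
    unfolding v_def using that near l
    by (intro convex_subset_combination[OF C, where y = "x n"] in_r) auto
  show xC: "x n \<in> C" for n
  proof (induction n)
    case 0
    then show ?case using it C by (simp add: iteration_ii_def)
  next
    case (Suc n)
    then have "S (n + 1) (v n (n + 1)) \<in> C"
      by (intro nonexpansive_self_mapD(1)[OF S] vC) auto
    then show ?case using x[of n] by simp
  qed
  \<comment> \<open>The next step and the step \<open>N\<close> later use the same map.\<close>
  have xN: "x (n + 1 + N) = S (n + 1) (v (n + N) (n + 1 + N))"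
    using x[of "n + N"] per[of "n + 1"] by (simp add: add_ac)
  have yz: "dist (x (n + N)) (x n) \<le> 2 * M"
    using dist_triangle2[of "x (n + N)" "x n" u] xM[of n] xM[of "n + N"] by simp
  have "dist (x (n + 1 + N)) (x (n + 1)) \<le> dist (v (n + N) (n + 1 + N)) (v n (n + 1))"
    unfolding xN x[of n] using xC by (intro nonexpansive_self_mapD(2)[OF S] vC) auto
  also have "\<dots> \<le> \<bar>l (n + 1 + N) - l (n + 1)\<bar> * dist u (x (n + N))
      + (1 - (1 - \<delta>) * l (n + 1)) * dist (x (n + N)) (x n)"
    unfolding v_def using near yz l by (intro convex_combination_dist[OF conv] in_r) auto
  also have "\<dots> \<le> \<bar>l (n + 1 + N) - l (n + 1)\<bar> * (2 * M)
      + (1 - (1 - \<delta>) * l (n + 1)) * dist (x (n + N)) (x n)"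
    using near by (intro add_right_mono mult_left_mono) auto
  finally show "dist (x (n + 1)) (x (n + 1 + N))
      \<le> (1 - (1 - \<delta>) * l (n + 1)) * dist (x n) (x (n + N)) + 2 * M * \<bar>l (n + 1 + N) - l (n + 1)\<bar>"
    by (simp add: dist_commute mult.commute add.commute)
  have "dist (x (n + 1)) (S (n + 1) (x n)) \<le> dist (v n (n + 1)) (x n)"
    unfolding x[of n] using xC by (intro nonexpansive_self_mapD(2)[OF S] vC) auto
  also have "\<dots> = l (n + 1) * dist u (x n)"
    unfolding v_def using near l by (intro geodesic_bicombing_dist_endpoint[OF bic] in_r) auto
  also have "\<dots> \<le> l (n + 1) * (2 * M)"
    using near l[of "n + 1"] by (intro mult_left_mono) auto
  finally show "dist (x (n + 1)) (S (n + 1) (x n)) \<le> 2 * M * l (n + 1)" by (simp add: mult.commute)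
qed

section \<open>Comparison with the cyclic composition\<close>

text \<open>
  Nonexpansive maps do not enlarge an error made earlier, so the errors of the single steps only
  add up.
\<close>

lemma perturbed_orbit_comp_block:
  assumes S: "\<And>n. n \<ge> 1 \<Longrightarrow> nonexpansive_self_map C (S n)"
    and xC: "\<And>n. x n \<in> C"
    and err: "\<And>m. n \<le> m \<Longrightarrow> dist (x (m + 1)) (S (m + 1) (x m)) \<le> e"
  shows "dist (x (n + k)) (comp_block S n k (x n)) \<le> real k * e"
proof -
  have "comp_block S n k (x n) \<in> C \<and> dist (x (n + k)) (comp_block S n k (x n)) \<le> real k * e"
  proof (induction k)
    case 0
    then show ?case using xC by simp
  next
    case (Suc k)
    let ?w = "comp_block S n k (x n)" and ?S = "S (n + k + 1)"
    have f: "nonexpansive_self_map C ?S" by (rule S) simp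
    have "dist (?S (x (n + k))) (?S ?w) \<le> dist (x (n + k)) ?w"
      using Suc xC by (intro nonexpansive_self_mapD(2)[OF f]) auto
    then have "dist (x (n + k + 1)) (?S ?w) \<le> e + real k * e"
      using dist_triangle[of "x (n + k + 1)" "?S ?w" "?S (x (n + k))"] err[of "n + k"] Suc by simp
    then show ?case
      using nonexpansive_self_mapD(1)[OF f] Suc by (simp add: algebra_simps)
  qed
  then show ?thesis ..
qed

lemma cyc_index_in: "N \<ge> 1 \<Longrightarrow> cyc_index N n \<in> {1..N}"
  unfolding cyc_index_def using mod_less_divisor[of N n] by (auto simp: less_imp_le)

lemma cyc_add_period: "cyc N T (n + N) = cyc N T n"
  by (simp add: cyc_def cyc_index_def fun_eq_iff)

section \<open>Rates of asymptotic regularity\<close>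

theorem theorem3p1:
  fixes r :: ereal and \<delta> M :: real
    and \<sigma> :: "'a::metric_space \<Rightarrow> 'a \<Rightarrow> real \<Rightarrow> 'a"
    and C :: "'a set" and N :: nat and T :: "nat \<Rightarrow> 'a \<Rightarrow> 'a" and u :: 'a
    and l :: "nat \<Rightarrow> real" and x :: "nat \<Rightarrow> 'a"
    and \<alpha> \<gamma> :: "real \<Rightarrow> nat" and \<theta> :: "nat \<Rightarrow> nat"
  assumes "0 < r" and "0 \<le> \<delta>" and "\<delta> < 1"
    and "convex_space r \<delta> \<sigma>"
    and "convex_subset r \<sigma> C"
    and "N \<ge> 1"
    and "\<forall>i\<in>{1..N}. nonexpansive_self_map C (T i)"
    and "u \<in> C"
    and "\<forall>n\<ge>1. l n \<in> {0..1}"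
    and "0 < M" and "ereal M \<le> r / 2"
    and "rate_of_divergence l \<theta>"
    and "cauchy_modulus (\<lambda>n. \<bar>l (n + N) - l n\<bar>) \<gamma>"
    and "(iteration_i \<sigma> (cyc N T) u l x \<and>
            (\<forall>n\<ge>1. dist (x n) u \<le> M) \<and> (\<forall>i\<in>{1..N}. dist u (T i u) \<le> M))
         \<or> (iteration_ii \<sigma> (cyc N T) u l x \<and> (\<forall>n\<ge>1. dist (x n) u \<le> M))"
  shows "rate_of_convergence (\<lambda>n. dist (x n) (x (n + N))) (\<lambda>\<epsilon>. Phi_tilde \<epsilon> M \<gamma> \<theta> \<delta>)
    \<and> (rate_of_convergence (\<lambda>n. l (n + 1)) \<alpha> \<longrightarrow>
        rate_of_convergence (\<lambda>n. dist (x n) (comp_block (cyc N T) n N (x n)))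
          (\<lambda>\<epsilon>. Phi \<epsilon> M \<gamma> \<theta> \<delta> N \<alpha>))"
proof -
  let ?S = "cyc N T"
  have l: "\<And>n. n \<ge> 1 \<Longrightarrow> l n \<in> {0..1}" using assms(9) by blast
  have S: "nonexpansive_self_map C (?S n)" for n
    using assms(6,7) cyc_index_in[of N n] unfolding cyc_def by blast
  have r: "ereal (2 * M) \<le> r"
  proof (cases r)
    case (real q)
    then show ?thesis using assms(11) by simp
  qed (use assms(1) in auto)
  have x0: "x 0 = u"
    using assms(14) unfolding iteration_i_def iteration_ii_def by blast
  have xM: "dist (x n) u \<le> M" for n
    using assms(10,14) x0 by (cases "n = 0") auto
  have est: "x n \<in> C
      \<and> dist (x (n + 1)) (x (n + 1 + N)) \<le> (1 - (1 - \<delta>) * l (n + 1)) * dist (x n) (x (n + N))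
          + 2 * M * \<bar>l (n + 1 + N) - l (n + 1)\<bar>
      \<and> dist (x (n + 1)) (?S (n + 1) (x n)) \<le> 2 * M * l (n + 1)" for n
    using assms(14)
  proof (elim disjE conjE)
    assume it: "iteration_i \<sigma> ?S u l x" and "\<forall>i\<in>{1..N}. dist u (T i u) \<le> M"
    then have uM: "dist u (?S n u) \<le> M" for n
      using cyc_index_in[OF assms(6), of n] unfolding cyc_def by blast
    show ?thesis
      using iteration_i_estimates[where N = N, OF it assms(4,5,8) S cyc_add_period l assms(2) r xM uM]
      by blast
  next
    assume it: "iteration_ii \<sigma> ?S u l x"
    show ?thesis
      using iteration_ii_estimates[where N = N, OF it assms(4,5,8) S cyc_add_period l assms(2) r xM]
      by blast
  qed
  have reg: "rate_of_convergence (\<lambda>n. dist (x n) (x (n + N))) (\<lambda>\<epsilon>. Phi_tilde \<epsilon> M \<gamma> \<theta> \<delta>)"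
  proof (rule contractive_recursion_rate[OF assms(2,3,10) l _ _ _ assms(12,13)])
    show "dist (x n) (x (n + N)) \<le> 2 * M" for n
      using dist_triangle2[of "x n" "x (n + N)" u] xM[of n] xM[of "n + N"] by simp
  qed (use est in auto)
  moreover have "rate_of_convergence (\<lambda>n. dist (x n) (comp_block ?S n N (x n)))
      (\<lambda>\<epsilon>. Phi \<epsilon> M \<gamma> \<theta> \<delta> N \<alpha>)" if \<alpha>: "rate_of_convergence (\<lambda>n. l (n + 1)) \<alpha>"
    unfolding rate_of_convergence_def
  proof (intro allI impI conjI)
    fix \<epsilon> :: real assume "0 < \<epsilon>"
    then have \<epsilon>: "0 < \<epsilon> / 2" by simp
    have \<epsilon>': "0 < \<epsilon> / (4 * M * real N)" using \<open>0 < \<epsilon>\<close> assms(6,10) by simp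
    show "1 \<le> Phi \<epsilon> M \<gamma> \<theta> \<delta> N \<alpha>"
      using \<alpha> \<epsilon>' unfolding rate_of_convergence_def Phi_def by (auto simp: le_max_iff_disj)
    fix n assume n: "Phi \<epsilon> M \<gamma> \<theta> \<delta> N \<alpha> \<le> n"
    have "dist (x n) (x (n + N)) \<le> \<epsilon> / 2"
      using reg \<epsilon> n unfolding rate_of_convergence_def Phi_def max.bounded_iff by blast
    moreover have "dist (x (n + N)) (comp_block ?S n N (x n)) \<le> real N * (\<epsilon> / (2 * real N))"
    proof (rule perturbed_orbit_comp_block[OF S])
      fix m assume "n \<le> m"
      then have "l (m + 1) \<le> \<epsilon> / (4 * M * real N)"
        using \<alpha> \<epsilon>' n unfolding rate_of_convergence_def Phi_def by auto
      then have "2 * M * l (m + 1) \<le> 2 * M * (\<epsilon> / (4 * M * real N))"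
        using assms(10) by (intro mult_left_mono) auto
      also have "\<dots> = \<epsilon> / (2 * real N)" using assms(10) by simp
      finally show "dist (x (m + 1)) (?S (m + 1) (x m)) \<le> \<epsilon> / (2 * real N)"
        using est[of m] by linarith
    qed (use est in auto)
    moreover have "real N * (\<epsilon> / (2 * real N)) = \<epsilon> / 2" using assms(6) by simp
    ultimately show "dist (x n) (comp_block ?S n N (x n)) \<le> \<epsilon>"
      using dist_triangle[of "x n" "comp_block ?S n N (x n)" "x (n + N)"] by linarith
  qed
  ultimately show ?thesis by blast
qed

end
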